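(* Let $X$ be a real Hilbert space. In the metric space $(\mathcal N(X),\rho)$, the set of weak contraction mappings, i.e., $$\mathcal K:=\Big\{T\in\mathcal N(X):\ \exists\,l>0\text{ such that }\|Tx-Ty\|^2\le\|x-y\|^2-l\big(\|x-y\|^2+\langle x-y,Tx-Ty\rangle\big)\ \ \forall x,y\in X\Big\},$$ is of first category.
   Context: $X$ is a real Hilbert space with inner product $\langle\cdot,\cdot\rangle$ and norm $\|\cdot\|$. $\mathcal N(X)$ is the set of nonexpansive maps $T:X\to X$, i.e., $\|Tx-Ty\|\le\|x-y\|$ for all $x,y\in X$. For $T_1,T_2\in\mathcal N(X)$ put $\|T_1-T_2\|_n:=\sup_{\|x\|\le n}\|T_1x-T_2x\|$ and $$\rho(T_1,T_2):=\sum_{n=1}^\infty\frac1{2^n}\frac{\|T_1-T_2\|_n}{1+\|T_1-T_2\|_n},$$ a metric on $\mathcal N(X)$. A subset of a metric space is of first category if it is a countable union of nowhere dense sets.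
   Formalization: The Hilbert space X is assumed to be nonzero: for X = {0} the space N(X) is a single point equal to K, which is not of first category in itself, so the claim fails there. *)

theory Defs
  imports "HOL-Analysis.Analysis"
begin

definition nowhere_dense_in :: "'a topology \<Rightarrow> 'a set \<Rightarrow> bool" where
  "nowhere_dense_in X A \<longleftrightarrow> A \<subseteq> topspace X \<and> X interior_of (X closure_of A) = {}"

definition first_category_in :: "'a topology \<Rightarrow> 'a set \<Rightarrow> bool" where
  "first_category_in X A \<longleftrightarrow>
     (\<exists>\<U>. countable \<U> \<and> (\<forall>N\<in>\<U>. nowhere_dense_in X N) \<and> A = \<Union>\<U>)"

definition nonexpansive_maps :: "('a::real_inner \<Rightarrow> 'a) set" where
  "nonexpansive_maps = {T. \<forall>x y. norm (T x - T y) \<le> norm (x - y)}"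

definition ball_sup_dist :: "nat \<Rightarrow> ('a::real_inner \<Rightarrow> 'a) \<Rightarrow> ('a \<Rightarrow> 'a) \<Rightarrow> real" where
  "ball_sup_dist n S T = (SUP x\<in>{x. norm x \<le> real n}. norm (S x - T x))"

text \<open>The supremum is only meaningful for maps bounded on balls. Off \<open>nonexpansive_maps\<close> the
  distance is set to 0 because the locale \<open>Metric_space\<close> demands nonnegativity and symmetry on
  the whole type, not only on the carrier.\<close>

definition nonexpansive_dist :: "('a::real_inner \<Rightarrow> 'a) \<Rightarrow> ('a \<Rightarrow> 'a) \<Rightarrow> real" where
  "nonexpansive_dist S T =
     (if S \<in> nonexpansive_maps \<and> T \<in> nonexpansive_maps
      then (\<Sum>k. let n = Suc k in
              1 / 2 ^ n * (ball_sup_dist n S T / (1 + ball_sup_dist n S T)))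
      else 0)"

definition weak_contractions :: "('a::real_inner \<Rightarrow> 'a) set" where
  "weak_contractions =
     {T \<in> nonexpansive_maps. \<exists>l>0. \<forall>x y.
        (norm (T x - T y))\<^sup>2 \<le>
          (norm (x - y))\<^sup>2 - l * ((norm (x - y))\<^sup>2 + inner (x - y) (T x - T y))}"

lemma nonexpansive_diff_bound:
  assumes "S \<in> nonexpansive_maps" "T \<in> nonexpansive_maps" "norm x \<le> r"
  shows "norm (S x - T x) \<le> 2 * r + norm (S 0 - T 0)"
proof -
  have "S x - T x = (S x - S 0) + (S 0 - T 0) - (T x - T 0)" by simp
  then have "norm (S x - T x) \<le> norm (S x - S 0) + norm (S 0 - T 0) + norm (T x - T 0)"
    by (metis norm_triangle_ineq norm_triangle_ineq4 order_trans add_right_mono)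
  moreover have "norm (S x - S 0) \<le> norm (x - 0)" "norm (T x - T 0) \<le> norm (x - 0)"
    using assms unfolding nonexpansive_maps_def by blast+
  ultimately show ?thesis using assms(3) by simp
qed

lemma nonexpansive_bdd_above:
  assumes "S \<in> nonexpansive_maps" "T \<in> nonexpansive_maps"
  shows "bdd_above ((\<lambda>x. norm (S x - T x)) ` {x. norm x \<le> real n})"
  using nonexpansive_diff_bound[OF assms] by (auto intro!: bdd_aboveI2)

lemma ball_sup_dist_upper:
  assumes "S \<in> nonexpansive_maps" "T \<in> nonexpansive_maps" "norm x \<le> real n"
  shows "norm (S x - T x) \<le> ball_sup_dist n S T"
  unfolding ball_sup_dist_def
  using nonexpansive_bdd_above[OF assms(1,2)] assms(3) by (intro cSUP_upper) auto

lemma ball_sup_dist_nonneg: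
  assumes "S \<in> nonexpansive_maps" "T \<in> nonexpansive_maps"
  shows "0 \<le> ball_sup_dist n S T"
  by (rule order_trans[OF norm_ge_zero ball_sup_dist_upper[OF assms, of 0 n]]) simp

lemma ball_sup_dist_commute: "ball_sup_dist n S T = ball_sup_dist n T S"
  unfolding ball_sup_dist_def by (simp add: norm_minus_commute)

lemma ball_sup_dist_triangle:
  assumes "R \<in> nonexpansive_maps" "S \<in> nonexpansive_maps" "T \<in> nonexpansive_maps"
  shows "ball_sup_dist n R T \<le> ball_sup_dist n R S + ball_sup_dist n S T"
proof -
  have "norm (R x - T x) \<le> ball_sup_dist n R S + ball_sup_dist n S T"
    if "norm x \<le> real n" for x
    using ball_sup_dist_upper[OF assms(1,2) that] ball_sup_dist_upper[OF assms(2,3) that]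
      norm_diff_triangle_ineq[of "R x" "S x" "S x" "T x"]
      norm_triangle_ineq[of "R x - S x" "S x - T x"] by simp
  moreover have "{x::'a. norm x \<le> real n} \<noteq> {}" by (auto intro!: exI[of _ 0])
  ultimately show ?thesis unfolding ball_sup_dist_def[of n R T] by (intro cSUP_least) auto
qed

lemma nonexpansive_dist_term_bounds:
  assumes "S \<in> nonexpansive_maps" "T \<in> nonexpansive_maps"
  shows "0 \<le> 1 / 2 ^ Suc k * (ball_sup_dist n S T / (1 + ball_sup_dist n S T))"
    and "1 / 2 ^ Suc k * (ball_sup_dist n S T / (1 + ball_sup_dist n S T)) \<le> (1 / 2) ^ k"
proof -
  let ?q = "ball_sup_dist n S T / (1 + ball_sup_dist n S T)"
  have b: "0 \<le> ?q" "?q \<le> 1"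
    using ball_sup_dist_nonneg[OF assms, of n] by (simp_all add: divide_simps)
  show "0 \<le> 1 / 2 ^ Suc k * ?q" by (rule mult_nonneg_nonneg[OF _ b(1)]) simp
  have "1 / 2 ^ Suc k * ?q \<le> 1 / 2 ^ Suc k" using b by (intro mult_left_le) auto
  also have "\<dots> \<le> (1 / 2) ^ k" by (simp add: power_divide divide_simps)
  finally show "1 / 2 ^ Suc k * ?q \<le> (1 / 2) ^ k" .
qed

lemma nonexpansive_dist_summable:
  assumes "S \<in> nonexpansive_maps" "T \<in> nonexpansive_maps"
  shows "summable (\<lambda>k. 1 / 2 ^ Suc k *
           (ball_sup_dist (Suc k) S T / (1 + ball_sup_dist (Suc k) S T)))"
proof (rule summable_comparison_test'[where N = 0])
  show "summable (\<lambda>k. (1 / 2 :: real) ^ k)" by (simp add: summable_geometric_iff)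
  show "norm (1 / 2 ^ Suc k *
           (ball_sup_dist (Suc k) S T / (1 + ball_sup_dist (Suc k) S T))) \<le> (1 / 2) ^ k" for k
    using nonexpansive_dist_term_bounds[OF assms, of k "Suc k"]
    by (simp only: real_norm_def abs_of_nonneg)
qed

lemma div_one_plus_subadd:
  fixes a b c :: real
  assumes "0 \<le> a" "0 \<le> b" "0 \<le> c" "a \<le> b + c"
  shows "a / (1 + a) \<le> b / (1 + b) + c / (1 + c)"
proof -
  have "a / (1 + a) \<le> (b + c) / (1 + (b + c))"
    using assms by (simp add: divide_simps) (simp add: algebra_simps)
  also have "\<dots> = b / (1 + (b + c)) + c / (1 + (b + c))" by (rule add_divide_distrib)
  also have "\<dots> \<le> b / (1 + b) + c / (1 + c)"
    using assms by (intro add_mono divide_left_mono) auto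
  finally show ?thesis .
qed

lemma Metric_space_nonexpansive:
  "Metric_space (nonexpansive_maps :: ('a::real_inner \<Rightarrow> 'a) set) nonexpansive_dist"
proof
  fix S T :: "'a \<Rightarrow> 'a"
  let ?t = "\<lambda>S T k. 1 / 2 ^ Suc k *
     (ball_sup_dist (Suc k) S T / (1 + ball_sup_dist (Suc k) S (T :: 'a \<Rightarrow> 'a)))"
  have eq: "nonexpansive_dist S T = (\<Sum>k. ?t S T k)"
    if "S \<in> nonexpansive_maps" "T \<in> nonexpansive_maps" for S T :: "'a \<Rightarrow> 'a"
    using that by (simp add: nonexpansive_dist_def Let_def)
  show "0 \<le> nonexpansive_dist S T"
  proof (cases "S \<in> nonexpansive_maps \<and> T \<in> nonexpansive_maps")
    case True
    then have "S \<in> nonexpansive_maps" "T \<in> nonexpansive_maps" by auto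
    then show ?thesis unfolding eq[OF \<open>S \<in> _\<close> \<open>T \<in> _\<close>]
      by (intro suminf_nonneg nonexpansive_dist_summable nonexpansive_dist_term_bounds(1))
  qed (auto simp: nonexpansive_dist_def)
  show "nonexpansive_dist S T = nonexpansive_dist T S"
    unfolding nonexpansive_dist_def using ball_sup_dist_commute[of _ S T] by auto
  assume ST: "S \<in> nonexpansive_maps" "T \<in> nonexpansive_maps"
  show "nonexpansive_dist S T = 0 \<longleftrightarrow> S = T"
  proof
    assume "S = T"
    have "ball_sup_dist n T T = 0" for n
    proof -
      have "(0::'a) \<in> {x. norm x \<le> real n}" by simp
      then have "{x::'a. norm x \<le> real n} \<noteq> {}" by blast
      then show ?thesis unfolding ball_sup_dist_def by simp
    qed
    then show "nonexpansive_dist S T = 0" using eq[OF ST] \<open>S = T\<close> by simp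
  next
    assume "nonexpansive_dist S T = 0"
    then have "(\<Sum>k. ?t S T k) = 0" using eq[OF ST] by simp
    then have z: "?t S T k = 0" for k
      using suminf_eq_zero_iff[OF nonexpansive_dist_summable[OF ST]
          nonexpansive_dist_term_bounds(1)[OF ST]] by blast
    show "S = T"
    proof
      fix x :: 'a
      obtain k where k: "norm x \<le> real (Suc k)"
        using real_arch_simple[of "norm x"] by (metis of_nat_Suc order_trans lessI less_imp_le of_nat_mono)
      have "ball_sup_dist (Suc k) S T = 0"
        using z[of k] ball_sup_dist_nonneg[OF ST, of "Suc k"] by (auto simp: divide_simps)
      then show "S x = T x" using ball_sup_dist_upper[OF ST k] by simp
    qed
  qed
next
  fix R S T :: "'a \<Rightarrow> 'a"
  assume RST: "R \<in> nonexpansive_maps" "S \<in> nonexpansive_maps" "T \<in> nonexpansive_maps"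
  let ?t = "\<lambda>S T k. 1 / 2 ^ Suc k *
     (ball_sup_dist (Suc k) S T / (1 + ball_sup_dist (Suc k) S (T :: 'a \<Rightarrow> 'a)))"
  have eq: "nonexpansive_dist S T = (\<Sum>k. ?t S T k)"
    if "S \<in> nonexpansive_maps" "T \<in> nonexpansive_maps" for S T :: "'a \<Rightarrow> 'a"
    using that by (simp add: nonexpansive_dist_def Let_def)
  have le: "?t R T k \<le> ?t R S k + ?t S T k" for k
  proof -
    have "ball_sup_dist (Suc k) R T / (1 + ball_sup_dist (Suc k) R T)
      \<le> ball_sup_dist (Suc k) R S / (1 + ball_sup_dist (Suc k) R S)
        + ball_sup_dist (Suc k) S T / (1 + ball_sup_dist (Suc k) S T)"
      by (intro div_one_plus_subadd ball_sup_dist_nonneg ball_sup_dist_triangle RST)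
    then show ?thesis
      unfolding distrib_left[symmetric] by (rule mult_left_mono) simp
  qed
  note s = nonexpansive_dist_summable[OF RST(1,2)] nonexpansive_dist_summable[OF RST(2,3)]
    nonexpansive_dist_summable[OF RST(1,3)]
  have "(\<Sum>k. ?t R T k) \<le> (\<Sum>k. ?t R S k + ?t S T k)"
    by (rule suminf_le[OF le s(3) summable_add[OF s(1,2)]])
  also have "\<dots> = (\<Sum>k. ?t R S k) + (\<Sum>k. ?t S T k)"
    by (rule suminf_add[OF s(1,2), symmetric])
  finally show "nonexpansive_dist R T \<le> nonexpansive_dist R S + nonexpansive_dist S T"
    using eq RST by simp
qed

definition nonexpansive_topology :: "('a::real_inner \<Rightarrow> 'a) topology" where
  "nonexpansive_topology = Metric_space.mtopology nonexpansive_maps nonexpansive_dist"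

end

theory Submission
  imports Defs
begin

text \<open>
  Since nonexpansiveness makes the bracket in the weak contraction inequality nonnegative, the
  condition weakens as the constant \<open>l\<close> decreases. The weak contractions are thus the countable
  union of the sets \<open>weak_contractions_with l\<close> with \<open>l = 1, 1/2, 1/3, \<dots>\<close>.
  Each of these is closed, because convergence in the metric implies pointwise convergence and
  the inequality survives pointwise limits.

  Each of them has empty interior as well. A weak contraction never satisfies
  \<open>S x - S y = x - y\<close> with \<open>x \<noteq> y\<close>. For an arbitrary nonexpansive \<open>T\<close> and small \<open>d > 0\<close>, such an
  \<open>S\<close> is found within uniform distance \<open>2 * d\<close> of \<open>T\<close>: precompose \<open>T\<close> with the radial shrinking
  \<open>x \<mapsto> max 0 (1 - d / norm x) x\<close>, which moves every point by at most \<open>d\<close> and makes the map constant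
  on the ball of radius \<open>d\<close>, and then subtract the tent function \<open>max 0 (d - norm x)\<close> times a unit
  vector \<open>e\<close>. The two summands vary on complementary regions, which keeps the sum
  nonexpansive, and \<open>S (d e) - S 0 = d e\<close>.
\<close>

section \<open>Convergence in the metric and pointwise convergence\<close>

lemma nonexpansive_dist_eq_suminf:
  assumes "S \<in> nonexpansive_maps" "T \<in> nonexpansive_maps"
  shows "nonexpansive_dist S T =
    (\<Sum>k. 1 / 2 ^ Suc k * (ball_sup_dist (Suc k) S T / (1 + ball_sup_dist (Suc k) S T)))"
  using assms by (simp add: nonexpansive_dist_def Let_def)

lemma ball_sup_dist_le_nonexpansive_dist:
  assumes "S \<in> nonexpansive_maps" "T \<in> nonexpansive_maps"
  shows "ball_sup_dist (Suc k) S T / (1 + ball_sup_dist (Suc k) S T)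
    \<le> 2 ^ Suc k * nonexpansive_dist S T"
proof -
  let ?q = "\<lambda>k. ball_sup_dist (Suc k) S T / (1 + ball_sup_dist (Suc k) S T)"
  have "(\<Sum>j\<in>{k}. 1 / 2 ^ Suc j * ?q j) \<le> (\<Sum>j. 1 / 2 ^ Suc j * ?q j)"
    by (rule sum_le_suminf[OF nonexpansive_dist_summable[OF assms]])
      (auto intro: nonexpansive_dist_term_bounds(1)[OF assms, simplified])
  then have "1 / 2 ^ Suc k * ?q k \<le> nonexpansive_dist S T"
    by (simp add: nonexpansive_dist_eq_suminf[OF assms])
  then have "2 ^ Suc k * (1 / 2 ^ Suc k * ?q k) \<le> 2 ^ Suc k * nonexpansive_dist S T"
    by (rule mult_left_mono) simp
  then show ?thesis by simp
qed

lemma nonexpansive_dist_tendsto_imp_pointwise: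
  fixes F :: "nat \<Rightarrow> 'a::real_inner \<Rightarrow> 'a"
  assumes F: "\<And>n. F n \<in> nonexpansive_maps" and S: "S \<in> nonexpansive_maps"
    and lim: "(\<lambda>n. nonexpansive_dist (F n) S) \<longlonglongrightarrow> 0"
  shows "(\<lambda>n. F n x) \<longlonglongrightarrow> S x"
proof -
  obtain k where k: "norm x \<le> real (Suc k)"
    by (metis real_arch_simple of_nat_Suc order_trans lessI less_imp_le of_nat_mono)
  define b where "b n = ball_sup_dist (Suc k) (F n) S" for n
  define q where "q n = b n / (1 + b n)" for n
  have b0: "0 \<le> b n" for n
    unfolding b_def by (rule ball_sup_dist_nonneg[OF F S])
  have up: "(\<lambda>n. 2 ^ Suc k * nonexpansive_dist (F n) S) \<longlonglongrightarrow> 0"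
    using tendsto_mult_left[OF lim, of "2 ^ Suc k"] by simp
  have "q \<longlonglongrightarrow> 0"
  proof (rule tendsto_sandwich[OF _ _ tendsto_const up])
    show "\<forall>\<^sub>F n in sequentially. 0 \<le> q n"
      using b0 by (simp add: q_def)
    show "\<forall>\<^sub>F n in sequentially. q n \<le> 2 ^ Suc k * nonexpansive_dist (F n) S"
      unfolding q_def b_def using ball_sup_dist_le_nonexpansive_dist[OF F S]
      by (intro always_eventually allI)
  qed
  \<comment> \<open>Invert \<open>b \<mapsto> b / (1 + b)\<close> to pass from \<open>q\<close> back to \<open>b\<close>.\<close>
  then have "(\<lambda>n. q n / (1 - q n)) \<longlonglongrightarrow> 0 / (1 - 0)"
    by (intro tendsto_intros) auto
  moreover have "q n / (1 - q n) = b n" for n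
  proof -
    have "1 + b n \<noteq> 0" using b0[of n] by linarith
    then show ?thesis unfolding q_def by (simp add: divide_simps)
  qed
  ultimately have "b \<longlonglongrightarrow> 0" by simp
  then have "(\<lambda>n. norm (F n x - S x)) \<longlonglongrightarrow> 0"
    by (rule tendsto_sandwich[OF _ _ tendsto_const, rotated 2])
      (use ball_sup_dist_upper[OF F S k] in \<open>auto simp: b_def simp del: of_nat_Suc\<close>)
  then show ?thesis
    using LIM_zero_cancel tendsto_norm_zero_iff by blast
qed

lemma nonexpansive_dist_le_uniform:
  assumes S: "S \<in> nonexpansive_maps" and T: "T \<in> nonexpansive_maps"
    and le: "\<And>x. norm (S x - T x) \<le> c"
  shows "nonexpansive_dist S T \<le> c"
proof -
  let ?b = "\<lambda>k. ball_sup_dist (Suc k) S T"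
  have b: "?b k / (1 + ?b k) \<le> c" for k
  proof -
    have "{x::'a. norm x \<le> real (Suc k)} \<noteq> {}" by (auto intro!: exI[of _ 0])
    then have "?b k \<le> c"
      unfolding ball_sup_dist_def by (intro cSUP_least le)
    moreover have "?b k / (1 + ?b k) \<le> ?b k"
      using ball_sup_dist_nonneg[OF S T, of "Suc k"]
      by (simp add: divide_simps algebra_simps)
    ultimately show ?thesis by linarith
  qed
  have half: "(\<lambda>k. 1 / 2 ^ Suc k * c) sums (1 * c)"
    using sums_mult2[OF power_half_series, of c] by (simp add: power_one_over)
  have "nonexpansive_dist S T \<le> (\<Sum>k. 1 / 2 ^ Suc k * c)"
    unfolding nonexpansive_dist_eq_suminf[OF S T]
    by (rule suminf_le[OF _ nonexpansive_dist_summable[OF S T] sums_summable[OF half]])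
      (intro mult_left_mono b, simp)
  also have "\<dots> = c" using sums_unique[OF half] by simp
  finally show ?thesis .
qed

section \<open>Weak contractions with a fixed constant\<close>

text \<open>The weak contractions for which the given number \<open>l\<close> serves as the constant.\<close>

definition weak_contractions_with :: "real \<Rightarrow> ('a::real_inner \<Rightarrow> 'a) set" where
  "weak_contractions_with l =
     {T \<in> nonexpansive_maps. \<forall>x y.
        (norm (T x - T y))\<^sup>2 \<le>
          (norm (x - y))\<^sup>2 - l * ((norm (x - y))\<^sup>2 + inner (x - y) (T x - T y))}"

lemma weak_contractions_with_antimono:
  assumes "l \<le> m"
  shows "weak_contractions_with m \<subseteq> weak_contractions_with l"
proof
  fix T :: "'a \<Rightarrow> 'a"
  assume T: "T \<in> weak_contractions_with m"
  have "(norm (T x - T y))\<^sup>2 \<le>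
      (norm (x - y))\<^sup>2 - l * ((norm (x - y))\<^sup>2 + inner (x - y) (T x - T y))" for x y
  proof -
    have "\<bar>inner (x - y) (T x - T y)\<bar> \<le> norm (x - y) * norm (T x - T y)"
      by (rule Cauchy_Schwarz_ineq2)
    also have "\<dots> \<le> norm (x - y) * norm (x - y)"
      using T by (intro mult_left_mono) (auto simp: weak_contractions_with_def nonexpansive_maps_def)
    finally have "0 \<le> (norm (x - y))\<^sup>2 + inner (x - y) (T x - T y)"
      by (simp add: power2_eq_square)
    then have "l * ((norm (x - y))\<^sup>2 + inner (x - y) (T x - T y))
        \<le> m * ((norm (x - y))\<^sup>2 + inner (x - y) (T x - T y))"
      by (rule mult_right_mono[OF assms])
    moreover have "(norm (T x - T y))\<^sup>2 \<le>
        (norm (x - y))\<^sup>2 - m * ((norm (x - y))\<^sup>2 + inner (x - y) (T x - T y))"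
      using T by (simp add: weak_contractions_with_def)
    ultimately show ?thesis by linarith
  qed
  then show "T \<in> weak_contractions_with l"
    using T by (simp add: weak_contractions_with_def)
qed

lemma weak_contractions_eq_Union:
  "weak_contractions = (\<Union>n. weak_contractions_with (inverse (real (Suc n))))"
proof (intro equalityI subsetI)
  fix T :: "'a \<Rightarrow> 'a"
  assume "T \<in> weak_contractions"
  then obtain l where l: "l > 0" "T \<in> weak_contractions_with l"
    unfolding weak_contractions_def weak_contractions_with_def by blast
  obtain n where "inverse (real (Suc n)) < l"
    using reals_Archimedean[OF l(1)] by blast
  then show "T \<in> (\<Union>n. weak_contractions_with (inverse (real (Suc n))))"
    using weak_contractions_with_antimono[of "inverse (real (Suc n))" l] l(2) by force
next
  fix T :: "'a \<Rightarrow> 'a"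
  assume "T \<in> (\<Union>n. weak_contractions_with (inverse (real (Suc n))))"
  then obtain n where "T \<in> weak_contractions_with (inverse (real (Suc n)))" by blast
  then show "T \<in> weak_contractions"
    unfolding weak_contractions_def weak_contractions_with_def
    by (auto intro!: exI[of _ "inverse (real (Suc n))"])
qed

lemma closedin_weak_contractions_with:
  "closedin nonexpansive_topology (weak_contractions_with l :: ('a::real_inner \<Rightarrow> 'a) set)"
proof -
  interpret Metric_space "nonexpansive_maps :: ('a \<Rightarrow> 'a) set" nonexpansive_dist
    by (rule Metric_space_nonexpansive)
  have "S \<in> weak_contractions_with l"
    if ran: "range F \<subseteq> weak_contractions_with l" and lim: "limitin mtopology F S sequentially"
    for F and S :: "'a \<Rightarrow> 'a"
  proof -
    have F: "F n \<in> nonexpansive_maps" for n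
      using ran by (auto simp: weak_contractions_with_def)
    have S: "S \<in> nonexpansive_maps" and "(\<lambda>n. nonexpansive_dist (F n) S) \<longlonglongrightarrow> 0"
      using lim by (auto simp: limitin_metric_dist_null)
    then have pw: "(\<lambda>n. F n x) \<longlonglongrightarrow> S x" for x
      using nonexpansive_dist_tendsto_imp_pointwise F by blast
    have "(norm (S x - S y))\<^sup>2 \<le>
        (norm (x - y))\<^sup>2 - l * ((norm (x - y))\<^sup>2 + inner (x - y) (S x - S y))" for x y
    proof (rule LIMSEQ_le)
      show "(\<lambda>n. (norm (F n x - F n y))\<^sup>2) \<longlonglongrightarrow> (norm (S x - S y))\<^sup>2"
        by (intro tendsto_intros pw)
      show "(\<lambda>n. (norm (x - y))\<^sup>2 - l * ((norm (x - y))\<^sup>2 + inner (x - y) (F n x - F n y)))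
        \<longlonglongrightarrow> (norm (x - y))\<^sup>2 - l * ((norm (x - y))\<^sup>2 + inner (x - y) (S x - S y))"
        by (intro tendsto_intros pw)
      show "\<exists>N. \<forall>n\<ge>N. (norm (F n x - F n y))\<^sup>2 \<le>
          (norm (x - y))\<^sup>2 - l * ((norm (x - y))\<^sup>2 + inner (x - y) (F n x - F n y))"
        using ran by (fastforce simp: weak_contractions_with_def)
    qed
    then show ?thesis using S by (simp add: weak_contractions_with_def)
  qed
  moreover have "weak_contractions_with l \<subseteq> (nonexpansive_maps :: ('a \<Rightarrow> 'a) set)"
    by (auto simp: weak_contractions_with_def)
  ultimately show ?thesis
    unfolding nonexpansive_topology_def metric_closedin_iff_sequentially_closed by blast
qed

lemma not_weak_contraction_with_if_translation:
  assumes "l > 0" "x \<noteq> y" "S x - S y = x - y"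
  shows "S \<notin> weak_contractions_with l"
proof
  assume "S \<in> weak_contractions_with l"
  then have "(norm (S x - S y))\<^sup>2 \<le>
      (norm (x - y))\<^sup>2 - l * ((norm (x - y))\<^sup>2 + inner (x - y) (S x - S y))"
    by (simp add: weak_contractions_with_def)
  then have "l * (2 * (norm (x - y))\<^sup>2) \<le> 0"
    using assms(3) by (simp add: power2_norm_eq_inner)
  moreover have "0 < l * (2 * (norm (x - y))\<^sup>2)"
    using assms by simp
  ultimately show False by linarith
qed

section \<open>Nonexpansive perturbations that are somewhere a translation\<close>

text \<open>The radial shrinking by \<open>d\<close>: points of norm at most \<open>d\<close> go to the origin, all
  others move towards it by the distance \<open>d\<close>. It is the identity minus the metric projection
  onto the closed ball of radius \<open>d\<close>.\<close>

definition radial_shrink :: "real \<Rightarrow> 'a::real_inner \<Rightarrow> 'a" where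
  "radial_shrink d x = (if norm x \<le> d then 0 else (1 - d / norm x) *\<^sub>R x)"

lemma norm_radial_shrink:
  assumes "0 \<le> d" "d \<le> norm x"
  shows "norm (radial_shrink d x) = norm x - d"
proof (cases "norm x = d")
  case False
  then have "0 < norm x" "d < norm x" using assms by linarith+
  then show ?thesis by (simp add: radial_shrink_def abs_if field_simps)
qed (simp add: radial_shrink_def)

lemma norm_radial_shrink_diff_le:
  assumes "0 \<le> d"
  shows "norm (radial_shrink d x - x) \<le> d"
proof (cases "norm x \<le> d")
  case False
  then have "radial_shrink d x - x = - ((d / norm x) *\<^sub>R x)"
    by (simp add: radial_shrink_def algebra_simps)
  then show ?thesis using assms by simp
qed (simp add: radial_shrink_def)

lemma radial_shrink_nonexpansive_outside:
  fixes x y :: "'a::real_inner"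
  assumes d: "0 \<le> d" and x: "d < norm x" and y: "d < norm y"
  shows "norm (radial_shrink d x - radial_shrink d y) \<le> norm (x - y)"
proof -
  define p q where "p = 1 - d / norm x" and "q = 1 - d / norm y"
  have n0: "0 < norm x" "0 < norm y" using assms by linarith+
  have p: "0 \<le> p" "p \<le> 1" and q: "0 \<le> q" "q \<le> 1"
    using assms n0 by (simp_all add: p_def q_def)
  have px: "p * norm x = norm x - d" and qy: "q * norm y = norm y - d"
    using n0 by (simp_all add: p_def q_def field_simps)
  \<comment> \<open>Shrinking preserves the difference of the norms and scales the Cauchy-Schwarz defect
    by \<open>p * q \<le> 1\<close>.\<close>
  have sq: "(norm (u - v))\<^sup>2 = (norm u - norm v)\<^sup>2 + 2 * (norm u * norm v - inner u v)"
    for u v :: 'a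
    by (simp add: power2_norm_eq_inner power2_diff inner_commute algebra_simps)
  have "p * q * (norm x * norm y - inner x y) \<le> 1 * (norm x * norm y - inner x y)"
    using p q norm_cauchy_schwarz[of x y]
    by (intro mult_right_mono mult_le_one) auto
  moreover have "(norm (p *\<^sub>R x - q *\<^sub>R y))\<^sup>2
      = (norm x - norm y)\<^sup>2 + 2 * (p * q * (norm x * norm y - inner x y))"
  proof -
    have np: "norm (p *\<^sub>R x) = p * norm x" and nq: "norm (q *\<^sub>R y) = q * norm y"
      using p q by simp_all
    have diff: "p * norm x - q * norm y = norm x - norm y"
      unfolding px qy by simp
    show ?thesis
      unfolding sq[of "p *\<^sub>R x"] np nq diff by (simp add: algebra_simps)
  qed
  ultimately have "(norm (p *\<^sub>R x - q *\<^sub>R y))\<^sup>2 \<le> (norm (x - y))\<^sup>2"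
    unfolding sq[of x y] by linarith
  then have "norm (p *\<^sub>R x - q *\<^sub>R y) \<le> norm (x - y)"
    by (rule power2_le_imp_le) simp
  then show ?thesis using x y by (simp add: radial_shrink_def p_def q_def)
qed

lemma nonexpansive_shrink_minus_tent:
  fixes T :: "'a::real_inner \<Rightarrow> 'a"
  assumes T: "T \<in> nonexpansive_maps" and d: "0 \<le> d" and e: "norm e = 1"
  shows "(\<lambda>x. T (radial_shrink d x) - max 0 (d - norm x) *\<^sub>R e) \<in> nonexpansive_maps"
    (is "?S \<in> _")
proof -
  have T': "norm (T u - T v) \<le> norm (u - v)" for u v
    using T by (simp add: nonexpansive_maps_def)
  \<comment> \<open>The tent has height \<open>d - norm x\<close> at \<open>x\<close> and the shrunk point of \<open>y\<close> has norm \<open>norm y - d\<close>;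
    these add up to \<open>norm y - norm x\<close>.\<close>
  have mixed: "norm (?S x - ?S y) \<le> norm (x - y)" if x: "norm x \<le> d" and y: "d < norm y" for x y
  proof -
    have "?S x - ?S y = (T (radial_shrink d x) - T (radial_shrink d y)) - (d - norm x) *\<^sub>R e"
      using x y by simp
    also have "norm \<dots> \<le> norm (T (radial_shrink d x) - T (radial_shrink d y))
        + norm ((d - norm x) *\<^sub>R e)"
      by (rule norm_triangle_ineq4)
    also have "\<dots> \<le> norm (radial_shrink d x - radial_shrink d y) + (d - norm x)"
      using T' x e by simp
    also have "\<dots> = norm y - norm x"
      using x y norm_radial_shrink[OF d, of y] by (simp add: radial_shrink_def[of d x])
    also have "\<dots> \<le> norm (x - y)"
      by (metis norm_minus_commute norm_triangle_ineq2)
    finally show ?thesis .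
  qed
  have "norm (?S x - ?S y) \<le> norm (x - y)" for x y
  proof -
    consider "norm x \<le> d" "norm y \<le> d" | "norm x \<le> d" "d < norm y"
      | "d < norm x" "norm y \<le> d" | "d < norm x" "d < norm y" by linarith
    then show ?thesis
    proof cases
      case 1
      then have "?S x - ?S y = (norm x - norm y) *\<^sub>R e"
        by (simp add: radial_shrink_def algebra_simps)
      then have "norm (?S x - ?S y) = \<bar>norm x - norm y\<bar>" using e by simp
      then show ?thesis using norm_triangle_ineq3[of x y] by simp
    next
      case 2
      then show ?thesis by (rule mixed)
    next
      case 3
      then show ?thesis using mixed[of y x] by (simp only: norm_minus_commute)
    next
      case 4
      then have "norm (?S x - ?S y) \<le> norm (radial_shrink d x - radial_shrink d y)"
        using T' by simp
      also have "\<dots> \<le> norm (x - y)"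
        using 4 by (rule radial_shrink_nonexpansive_outside[OF d])
      finally show ?thesis .
    qed
  qed
  then show ?thesis by (simp add: nonexpansive_maps_def)
qed

lemma nonexpansive_approx_by_local_translation:
  fixes T :: "'a::real_inner \<Rightarrow> 'a"
  assumes T: "T \<in> nonexpansive_maps" and "0 < r" and "\<exists>z :: 'a. z \<noteq> 0"
  obtains S x y where "S \<in> nonexpansive_maps" "nonexpansive_dist T S < r"
    "x \<noteq> y" "S x - S y = x - y"
proof -
  obtain z :: 'a where "z \<noteq> 0" using assms(3) by blast
  define e where "e = sgn z"
  have e: "norm e = 1" using \<open>z \<noteq> 0\<close> by (simp add: e_def norm_sgn)
  define d where "d = r / 3"
  have d: "0 < d" using \<open>0 < r\<close> by (simp add: d_def)
  define S where "S = (\<lambda>x. T (radial_shrink d x) - max 0 (d - norm x) *\<^sub>R e)"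
  have S: "S \<in> nonexpansive_maps"
    unfolding S_def using nonexpansive_shrink_minus_tent[OF T _ e] d by simp
  have "norm (T x - S x) \<le> 2 * d" for x
  proof -
    have "norm (T x - S x) = norm ((T x - T (radial_shrink d x)) + max 0 (d - norm x) *\<^sub>R e)"
      by (simp add: S_def algebra_simps)
    also have "\<dots> \<le> norm (T x - T (radial_shrink d x)) + norm (max 0 (d - norm x) *\<^sub>R e)"
      by (rule norm_triangle_ineq)
    also have "\<dots> \<le> norm (x - radial_shrink d x) + max 0 (d - norm x)"
      using T e by (simp add: nonexpansive_maps_def)
    also have "norm (x - radial_shrink d x) \<le> d"
      using norm_radial_shrink_diff_le[of d x] d by (simp add: norm_minus_commute)
    finally show ?thesis using d norm_ge_zero[of x] by linarith
  qed
  then have "nonexpansive_dist T S \<le> 2 * d"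
    by (rule nonexpansive_dist_le_uniform[OF T S])
  then have "nonexpansive_dist T S < r"
    using \<open>0 < r\<close> by (simp add: d_def)
  moreover have "d *\<^sub>R e \<noteq> 0" using d e by auto
  moreover have "S (d *\<^sub>R e) - S 0 = d *\<^sub>R e - 0"
    using d e by (simp add: S_def radial_shrink_def)
  ultimately show thesis using that S by blast
qed

lemma nowhere_dense_weak_contractions_with:
  assumes "\<exists>z :: 'a::real_inner. z \<noteq> 0" and "l > 0"
  shows "nowhere_dense_in nonexpansive_topology (weak_contractions_with l :: ('a \<Rightarrow> 'a) set)"
proof -
  interpret Metric_space "nonexpansive_maps :: ('a \<Rightarrow> 'a) set" nonexpansive_dist
    by (rule Metric_space_nonexpansive)
  let ?K = "weak_contractions_with l :: ('a \<Rightarrow> 'a) set"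
  have "T \<notin> mtopology interior_of ?K" for T
  proof
    assume T: "T \<in> mtopology interior_of ?K"
    then obtain r where r: "0 < r" "mball T r \<subseteq> mtopology interior_of ?K"
      using openin_interior_of[of mtopology ?K] unfolding openin_mtopology by blast
    have "T \<in> nonexpansive_maps"
      using T interior_of_subset by (fastforce simp: weak_contractions_with_def)
    then obtain S x y where S: "S \<in> nonexpansive_maps" "nonexpansive_dist T S < r"
      and xy: "x \<noteq> y" "S x - S y = x - y"
      using nonexpansive_approx_by_local_translation[OF _ r(1) assms(1)] by blast
    have "S \<in> mball T r"
      using \<open>T \<in> nonexpansive_maps\<close> S by simp
    then have "S \<in> ?K"
      using r(2) interior_of_subset[of mtopology ?K] by blast
    then show False
      using not_weak_contraction_with_if_translation[of l x y S, OF assms(2) xy] by blast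
  qed
  moreover have "?K \<subseteq> topspace nonexpansive_topology"
    by (rule closedin_subset[OF closedin_weak_contractions_with])
  ultimately show ?thesis
    unfolding nowhere_dense_in_def closure_of_closedin[OF closedin_weak_contractions_with]
    unfolding nonexpansive_topology_def by blast
qed

theorem theorem3p8:
  assumes "\<exists>x :: 'a :: {real_inner, complete_space}. x \<noteq> 0"
  shows "first_category_in nonexpansive_topology (weak_contractions :: ('a \<Rightarrow> 'a) set)"
  unfolding first_category_in_def
proof (intro exI conjI ballI)
  let ?\<U> = "range (\<lambda>n. weak_contractions_with (inverse (real (Suc n))) :: ('a \<Rightarrow> 'a) set)"
  show "countable ?\<U>" by simp
  show "weak_contractions = \<Union> ?\<U>" by (rule weak_contractions_eq_Union)
  show "nowhere_dense_in nonexpansive_topology N" if "N \<in> ?\<U>" for N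
    using that nowhere_dense_weak_contractions_with[OF assms] by force
qed

end
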